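(* Let $\kappa$ be an infinite cardinal. If $\kappa$ is a strong limit and $\kappa^{\aleph_0}>\kappa$, then there does not exist a compact linearly ordered space of size $\kappa$ in which all nonempty open sets are equipollent. If $\kappa$ is singular, then there does not exist a linearly ordered continuum $X$ with $\hat w(X)=\kappa$ and $|X|<\kappa^{\aleph_0}$.
   Context: An infinite cardinal $\kappa$ is a strong limit if $2^\theta<\kappa$ for every cardinal $\theta<\kappa$. The size of a space is the cardinality of its underlying set, and two sets are equipollent if they have the same cardinality. For a space $X$, $\hat w(X)$ is the smallest possible weight of a nonempty open subspace of $X$. A linearly ordered space is a topological space whose topology is the order topology of some linear ordering of its point set. A continuum is a compact connected Hausdorff space with more than one point. A linearly ordered continuum is a linearly ordered space that is a continuum. *)

theory Defs
  imports "HOL-Analysis.Analysis"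
begin

unbundle cardinal_syntax

text \<open>
  Cardinals are the relations \<open>r\<close> with \<^term>\<open>Card_order r\<close>, compared by \<open>\<le>o\<close>, \<open><o\<close> and \<open>=o\<close>.
  Quantifying over cardinals on the type of \<open>\<kappa>\<close> loses nothing below: every cardinal \<open>\<theta> <o \<kappa>\<close>,
  on any type, is equivalent to the cardinality of a subset of \<^term>\<open>Field \<kappa>\<close>.
\<close>

definition strong_limit :: "'k rel \<Rightarrow> bool" where
  "strong_limit \<kappa> \<longleftrightarrow> (\<forall>\<theta> :: 'k rel. Card_order \<theta> \<and> \<theta> <o \<kappa> \<longrightarrow> ctwo ^c \<theta> <o \<kappa>)"

lemma strong_limitD:
  fixes \<kappa> :: "'k rel" and \<theta> :: "'l rel"
  assumes "strong_limit \<kappa>" "Card_order \<kappa>" "Card_order \<theta>" "\<theta> <o \<kappa>"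
  shows "ctwo ^c \<theta> <o \<kappa>"
proof -
  obtain \<theta>' :: "'k rel" where \<theta>': "\<theta> =o \<theta>'" "Card_order \<theta>'"
    using assms internalize_card_of_ordLess[of "Field \<theta>" \<kappa>] card_of_Field_ordIso[of \<theta>]
    by (metis card_of_Card_order ordIso_ordLess_trans ordIso_symmetric ordIso_transitive)
  then have "ctwo ^c \<theta>' <o \<kappa>"
    using assms by (meson ordIso_ordLess_trans ordIso_symmetric strong_limit_def)
  moreover have "ctwo ^c \<theta> =o ctwo ^c \<theta>'"
    using \<theta>' assms by (intro cexp_cong2 Card_order_ctwo)
  ultimately show ?thesis
    using ordIso_ordLess_trans by blast
qed

text \<open>
  The open rays alone do not cover a one-point set, hence the whole set is added to the subbase.
\<close>

definition order_topology_on :: "'a set \<Rightarrow> 'a rel \<Rightarrow> 'a topology" where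
  "order_topology_on A r = topology_generated_by
     (insert A ((\<lambda>a. {x \<in> A. (x, a) \<in> r \<and> x \<noteq> a}) ` A \<union> (\<lambda>a. {x \<in> A. (a, x) \<in> r \<and> x \<noteq> a}) ` A))"

lemma topspace_order_topology_on [simp]: "topspace (order_topology_on A r) = A"
  unfolding order_topology_on_def by auto

definition linearly_ordered_space :: "'a topology \<Rightarrow> bool" where
  "linearly_ordered_space X \<longleftrightarrow>
     (\<exists>r. linear_order_on (topspace X) r \<and> X = order_topology_on (topspace X) r)"

lemma order_topology_on_UNIV:
  "order_topology_on UNIV {(x, y). x \<le> y} = (euclidean :: 'a::linorder_topology topology)"
proof -
  let ?S = "insert UNIV ((\<lambda>a::'a. {x. x < a}) ` UNIV \<union> (\<lambda>a. {x. a < x}) ` UNIV)"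
  have "order_topology_on UNIV {(x, y). x \<le> y} = topology_generated_by ?S"
    by (simp add: order_topology_on_def order.strict_iff_order eq_commute)
  moreover have "generate_topology_on ?S U" if "open U" for U
    using that unfolding open_generated_order
  proof induction
    case UNIV
    show ?case by (rule generate_topology_on.Basis) simp
  next
    case (Int a b)
    then show ?case by (auto intro: generate_topology_on.Int)
  next
    case (UN K)
    then show ?case by (auto intro: generate_topology_on.UN)
  next
    case (Basis s)
    then show ?case
      by (intro generate_topology_on.Basis) (auto simp: lessThan_def greaterThan_def)
  qed
  moreover have "open U" if "generate_topology_on ?S U" for U
    using that
  proof induction
    case (Basis s)
    then show ?case
      using open_lessThan open_greaterThan by (auto simp: lessThan_def greaterThan_def)
  qed auto
  ultimately show ?thesis
    by (auto simp: topology_eq openin_topology_generated_by_iff)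
qed

definition continuum :: "'a topology \<Rightarrow> bool" where
  "continuum X \<longleftrightarrow> compact_space X \<and> connected_space X \<and> Hausdorff_space X \<and>
     (\<exists>x \<in> topspace X. \<exists>y \<in> topspace X. x \<noteq> y)"

text \<open>A least element of a nonempty set of cardinals, which is unique only up to \<open>=o\<close>.\<close>

definition min_card :: "'k rel set \<Rightarrow> 'k rel" where
  "min_card R = (SOME r. r \<in> R \<and> (\<forall>r' \<in> R. r \<le>o r'))"

lemma min_card:
  assumes "R \<noteq> {}" "\<And>r. r \<in> R \<Longrightarrow> Card_order r"
  shows min_card_in: "min_card R \<in> R"
    and min_card_le: "\<And>r. r \<in> R \<Longrightarrow> min_card R \<le>o r"
proof -
  have "\<exists>r. r \<in> R \<and> (\<forall>r' \<in> R. r \<le>o r')"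
    using exists_minim_Card_order[of R] assms by blast
  then have "min_card R \<in> R \<and> (\<forall>r' \<in> R. min_card R \<le>o r')"
    unfolding min_card_def by (rule someI_ex)
  then show "min_card R \<in> R" "\<And>r. r \<in> R \<Longrightarrow> min_card R \<le>o r" by auto
qed

definition base_of :: "'a topology \<Rightarrow> 'a set set \<Rightarrow> bool" where
  "base_of X \<B> \<longleftrightarrow> openin X = arbitrary union_of (\<lambda>U. U \<in> \<B>)"

lemma base_of_openin: "base_of X {U. openin X U}"
  unfolding base_of_def by (auto simp: openin_topology_base_unique)

definition weight :: "'a topology \<Rightarrow> 'a set rel" where
  "weight X = min_card {|\<B>| | \<B>. base_of X \<B>}"

lemma weight_attained: "\<exists>\<B>. base_of X \<B> \<and> weight X = |\<B>|"
  and weight_le: "base_of X \<B> \<Longrightarrow> weight X \<le>o |\<B>|"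
proof -
  let ?R = "{|\<B>| | \<B>. base_of X \<B>}"
  have R: "?R \<noteq> {}" "\<And>r. r \<in> ?R \<Longrightarrow> Card_order r"
    using base_of_openin[of X] card_of_Card_order by auto
  show "\<exists>\<B>. base_of X \<B> \<and> weight X = |\<B>|"
    using min_card_in[OF R] unfolding weight_def by blast
  show "base_of X \<B> \<Longrightarrow> weight X \<le>o |\<B>|"
    using min_card_le[OF R] unfolding weight_def by blast
qed

lemma Card_order_weight: "Card_order (weight X)"
  using weight_attained[of X] card_of_Card_order by auto

text \<open>Meaningful only for spaces with nonempty \<^term>\<open>topspace X\<close>.\<close>

definition min_open_weight :: "'a topology \<Rightarrow> 'a set rel" where
  "min_open_weight X = min_card {weight (subtopology X U) | U. openin X U \<and> U \<noteq> {}}"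

lemma
  assumes "topspace X \<noteq> {}"
  shows min_open_weight_attained:
      "\<exists>U. openin X U \<and> U \<noteq> {} \<and> min_open_weight X = weight (subtopology X U)"
    and min_open_weight_le:
      "\<And>U. openin X U \<Longrightarrow> U \<noteq> {} \<Longrightarrow> min_open_weight X \<le>o weight (subtopology X U)"
proof -
  let ?R = "{weight (subtopology X U) | U. openin X U \<and> U \<noteq> {}}"
  have R: "?R \<noteq> {}" "\<And>r. r \<in> ?R \<Longrightarrow> Card_order r"
    using assms openin_topspace[of X] Card_order_weight by blast+
  show "\<exists>U. openin X U \<and> U \<noteq> {} \<and> min_open_weight X = weight (subtopology X U)"
    using min_card_in[OF R] unfolding min_open_weight_def by blast
  show "\<And>U. openin X U \<Longrightarrow> U \<noteq> {} \<Longrightarrow> min_open_weight X \<le>o weight (subtopology X U)"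
    using min_card_le[OF R] unfolding min_open_weight_def by blast
qed

end

theory Submission
  imports Defs
begin

text \<open>
  Both nonexistence claims are lower bounds \<open>\<kappa> ^ \<aleph>\<^sub>0 \<le> |X|\<close> obtained from one construction. Suppose
  that \<open>X\<close> is a compact Hausdorff space in which every nonempty open set contains \<open>\<kappa>\<close> pairwise
  disjoint nonempty open sets. Iterating inside the chosen sets, with closures shrinking into the
  previous set, gives a tree whose branches are the sequences \<open>nat \<Rightarrow> \<kappa>\<close>; compactness puts a point
  on each branch, and different branches get different points
  (\<open>nat_sequences_le_compact_Hausdorff\<close>).

  To split an open set into \<open>\<kappa>\<close> pieces for a singular \<open>\<kappa>\<close>, it is enough to split every nonempty open
  set into \<open>\<theta>\<close> pieces for each \<open>\<theta> < \<kappa>\<close>: first split into cofinality many pieces, then split the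
  pieces into larger and larger numbers of pieces, cofinal in \<open>\<kappa>\<close>
  (\<open>singular_disjoint_open_family\<close>).

  Splitting into \<open>\<theta> < \<kappa>\<close> pieces can only fail if a nonempty interval has a dense subset of size
  below \<open>\<kappa>\<close>. This is Kurepa's inequality: a dense linear order in which disjoint families of
  intervals have size at most \<open>\<mu>\<close> has a dense subset of size at most \<open>\<mu>\<^sup>+\<close>
  (\<open>dense_subset_card_le_cardSuc_cellularity\<close>), and \<open>\<mu>\<^sup>+ < \<kappa>\<close> because a singular cardinal is a limit
  cardinal. Such small dense subsets are impossible in both situations. In a continuum, the
  intervals with endpoints in a dense set \<open>D\<close> form a base, so an interval would have weight below
  \<open>\<kappa>\<close>. In a space whose nonempty open sets all have size \<open>\<kappa>\<close>, a dense set \<open>D\<close> of an interval gives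
  \<open>\<kappa> \<le> 2 ^ 2 ^ |D|\<close>, which contradicts that \<open>\<kappa>\<close> is a strong limit.

  In the first claim \<open>\<kappa>\<close> is singular unless it is \<open>\<aleph>\<^sub>0\<close>: a regular uncountable strong limit satisfies
  \<open>\<kappa> ^ \<aleph>\<^sub>0 = \<kappa>\<close>, since every sequence in it is bounded. For \<open>\<kappa> = \<aleph>\<^sub>0\<close>, a compact Hausdorff space
  without isolated points is uncountable.
\<close>

section \<open>Kurepa's inequality for dense linear orders\<close>

text \<open>
  Colour the points along the well-founded relation: a point has fewer forbidden colours, those of
  its predecessors, than there are colours.
\<close>

lemma greedy_colouring:
  fixes R :: "'a rel" and M :: "'b set"
  assumes "wf R" and pred: "\<And>x. |{y. (y, x) \<in> R}| <o |M|"
  obtains h :: "'a \<Rightarrow> 'b" where "\<And>x. h x \<in> M" "\<And>x y. (y, x) \<in> R \<Longrightarrow> h y \<noteq> h x"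
proof -
  have "\<exists>h :: 'a \<Rightarrow> 'b. \<forall>x. h x \<in> M \<and> (\<forall>y. (y, x) \<in> R \<longrightarrow> h y \<noteq> h x)"
  proof (rule dependent_wf_choice[OF \<open>wf R\<close>])
    fix x and h :: "'a \<Rightarrow> 'b"
    have "|h ` {y. (y, x) \<in> R}| <o |M|"
      using card_of_image pred ordLeq_ordLess_trans by blast
    then have "\<not> M \<subseteq> h ` {y. (y, x) \<in> R}"
      using card_of_mono1 not_ordLess_ordLeq by blast
    then show "\<exists>c. c \<in> M \<and> (\<forall>y. (y, x) \<in> R \<longrightarrow> h y \<noteq> c)"
      by blast
  qed auto
  then show ?thesis using that by blast
qed

lemma well_order_least:
  assumes "well_order_on UNIV r" "A \<noteq> {}"
  obtains s where "s \<in> A" "\<And>z. z \<in> A \<Longrightarrow> (s, z) \<in> r"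
proof -
  have "wf (r - Id)" and tot: "\<And>x y. x \<noteq> y \<Longrightarrow> (x, y) \<in> r \<or> (y, x) \<in> r" and refl: "\<And>x. (x, x) \<in> r"
    using assms(1) by (auto simp: order_on_defs total_on_def refl_on_def)
  moreover obtain x where "x \<in> A"
    using assms(2) by blast
  ultimately obtain s where s: "s \<in> A" and min: "\<And>z. (z, s) \<in> r - Id \<Longrightarrow> z \<notin> A"
    by (metis wfE_min)
  have "(s, z) \<in> r" if "z \<in> A" for z
    using min[of z] tot[of s z] refl[of s] that by blast
  with s show ?thesis by (rule that)
qed

locale strict_linear_order =
  fixes S :: "'a set" and lt :: "'a \<Rightarrow> 'a \<Rightarrow> bool"
  assumes irrefl: "\<not> lt x x"
    and trans: "lt x y \<Longrightarrow> lt y z \<Longrightarrow> lt x z"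
    and total: "x \<in> S \<Longrightarrow> y \<in> S \<Longrightarrow> x \<noteq> y \<Longrightarrow> lt x y \<or> lt y x"
begin

definition between :: "'a \<Rightarrow> 'a \<Rightarrow> 'a set" where
  "between p q = {z \<in> S. lt p z \<and> lt z q}"

lemma dual: "strict_linear_order S (\<lambda>x y. lt y x)"
  by unfold_locales (use irrefl trans total in blast)+

end

text \<open>
  On a set \<open>L\<close> on which the linear order agrees with a well-order, every point has an immediate
  successor in \<open>L \<union> {y}\<close>, where \<open>y\<close> is a bound of \<open>L\<close>. The intervals between consecutive points are
  disjoint, so the bound on disjoint families of intervals applies to \<open>L\<close>.
\<close>

lemma (in strict_linear_order) card_chain_le:
  fixes r :: "'a rel" and \<mu> :: "'m rel"
  assumes cell: "\<And>I P Q. \<lbrakk>I \<subseteq> S; \<And>i. i \<in> I \<Longrightarrow> P i \<in> S \<and> Q i \<in> S \<and> lt (P i) (Q i);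
      disjoint_family_on (\<lambda>i. between (P i) (Q i)) I\<rbrakk> \<Longrightarrow> |I| \<le>o \<mu>"
    and wo: "well_order_on UNIV r"
    and y: "y \<in> S" and L: "L \<subseteq> S" "\<And>x. x \<in> L \<Longrightarrow> lt x y"
    and mono: "\<And>x x'. x \<in> L \<Longrightarrow> x' \<in> L \<Longrightarrow> lt x x' \<Longrightarrow> (x, x') \<in> r"
  shows "|L| \<le>o \<mu>"
proof -
  have "antisym r"
    using wo by (auto simp: order_on_defs)
  have "\<exists>s \<in> S. lt x s \<and> (\<forall>x' \<in> L. lt x x' \<longrightarrow> \<not> lt x' s)" if "x \<in> L" for x
  proof (cases "\<exists>x' \<in> L. lt x x'")
    case True
    then have "{x' \<in> L. lt x x'} \<noteq> {}" by blast
    from well_order_least[OF wo this]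
    obtain s where s: "s \<in> L" "lt x s" and least: "\<And>z. z \<in> L \<Longrightarrow> lt x z \<Longrightarrow> (s, z) \<in> r"
      by (metis (mono_tags, lifting) mem_Collect_eq)
    have "\<not> lt x' s" if "x' \<in> L" "lt x x'" for x'
      using mono[OF \<open>x' \<in> L\<close> \<open>s \<in> L\<close>] least[OF that] irrefl antisymD[OF \<open>antisym r\<close>] by metis
    then show ?thesis using s L by blast
  next
    case False
    then show ?thesis using y L that by blast
  qed
  then obtain s where s: "\<And>x. x \<in> L \<Longrightarrow> s x \<in> S \<and> lt x (s x)"
      "\<And>x x'. x \<in> L \<Longrightarrow> x' \<in> L \<Longrightarrow> lt x x' \<Longrightarrow> \<not> lt x' (s x)"
    by metis
  have "between x (s x) \<inter> between x' (s x') = {}" if "x \<in> L" "x' \<in> L" "lt x x'" for x x'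
    using s(2)[OF that] trans unfolding between_def by blast
  then have "disjoint_family_on (\<lambda>x. between x (s x)) L"
    unfolding disjoint_family_on_def using total L(1) by (metis inf_commute subsetD)
  then show ?thesis
    using cell[of L "\<lambda>x. x" s] s(1) L(1) by blast
qed

text \<open>
  Fix a well-order \<open>r\<close> of the points. Let \<open>C x\<close> be the largest convex set of which \<open>x\<close> is the
  \<open>r\<close>-least element, and let \<open>D\<close> consist of the points \<open>x\<close> such that \<open>C x\<close> contains an interval
  around \<open>x\<close>. The \<open>r\<close>-least point of an interval belongs to \<open>D\<close>, so \<open>D\<close> is dense.

  The sets \<open>C x\<close> form a tree: if two of them meet, the one with the \<open>r\<close>-smaller point contains the
  other point. The ancestors of a point split into those to its left and those to its right. On each
  side moving towards the point means increasing in \<open>r\<close>, so there are at most \<open>\<mu>\<close> ancestors.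
  Hence \<open>D\<close> can be coloured with \<open>\<mu>\<^sup>+\<close> colours such that no point has the colour of an ancestor.
  Points of one colour have disjoint sets \<open>C x\<close>, so each colour is used at most \<open>\<mu>\<close> times.
\<close>

theorem (in strict_linear_order) dense_subset_card_le_cardSuc_cellularity:
  fixes \<mu> :: "'m rel"
  assumes dense: "\<And>x y. x \<in> S \<Longrightarrow> y \<in> S \<Longrightarrow> lt x y \<Longrightarrow> between x y \<noteq> {}"
    and \<mu>: "Cinfinite \<mu>"
    and cell: "\<And>I P Q. \<lbrakk>I \<subseteq> S; \<And>i. i \<in> I \<Longrightarrow> P i \<in> S \<and> Q i \<in> S \<and> lt (P i) (Q i);
      disjoint_family_on (\<lambda>i. between (P i) (Q i)) I\<rbrakk> \<Longrightarrow> |I| \<le>o \<mu>"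
  obtains D where "D \<subseteq> S" "|D| \<le>o cardSuc \<mu>"
    "\<And>p q. p \<in> S \<Longrightarrow> q \<in> S \<Longrightarrow> lt p q \<Longrightarrow> D \<inter> between p q \<noteq> {}"
proof -
  obtain r :: "'a rel" where wo: "well_order_on UNIV r"
    using well_ordering by metis
  then have wfr: "wf (r - Id)" and total_r: "\<And>x y. (x, y) \<in> r \<or> (y, x) \<in> r"
    and trans_r: "\<And>x y z. (x, y) \<in> r \<Longrightarrow> (y, z) \<in> r \<Longrightarrow> (x, z) \<in> r"
    unfolding order_on_defs trans_def total_on_def refl_on_def by (blast, metis UNIV_I, blast)
  \<comment> \<open>The convex hull of \<open>x\<close> and \<open>z\<close>, whichever of them is the smaller one.\<close>
  define seg where "seg x z = {w \<in> S. w = x \<or> w = z \<or> lt x w \<and> lt w z \<or> lt z w \<and> lt w x}" for x z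
  define C where "C x = {z \<in> S. \<forall>w \<in> seg x z. (x, w) \<in> r}" for x
  define D where "D = {x \<in> S. \<exists>p q. p \<in> S \<and> q \<in> S \<and> lt p x \<and> lt x q \<and> between p q \<subseteq> C x}"
  have nested: "y \<in> C x" if "x \<in> S" "y \<in> S" "(x, y) \<in> r" and int: "C x \<inter> C y \<noteq> {}" for x y
  proof -
    obtain z where z: "z \<in> C x" "z \<in> C y" using int by blast
    have "(x, w) \<in> r" if "w \<in> seg x y" for w
    proof -
      have "w \<in> seg x z \<union> seg y z"
        using that z \<open>x \<in> S\<close> \<open>y \<in> S\<close> total[of w z] trans unfolding seg_def C_def by blast
      then show ?thesis
        using z \<open>(x, y) \<in> r\<close> trans_r unfolding C_def by blast
    qed
    then show ?thesis using \<open>y \<in> S\<close> unfolding C_def by blast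
  qed
  have meets: "D \<inter> between p q \<noteq> {}" if pq: "p \<in> S" "q \<in> S" "lt p q" for p q
  proof -
    obtain x where x: "x \<in> between p q" and min: "\<And>w. w \<in> between p q \<Longrightarrow> (x, w) \<in> r"
      using well_order_least[OF wo dense[OF pq]] by metis
    have "seg x z \<subseteq> between p q" if "z \<in> between p q" for z
      using that x(1) trans unfolding seg_def between_def by blast
    then have "between p q \<subseteq> C x"
      using min unfolding C_def between_def by blast
    then show ?thesis using x(1) pq unfolding D_def between_def by blast
  qed
  have few: "|{x \<in> S. x \<noteq> y \<and> y \<in> C x}| \<le>o \<mu>" if y: "y \<in> S" for y
  proof -
    let ?A = "{x \<in> S. x \<noteq> y \<and> y \<in> C x}"
    have "|{x \<in> ?A. lt x y}| \<le>o \<mu>"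
    proof (rule card_chain_le[OF cell wo y])
      show "(x, x') \<in> r" if "x \<in> {x \<in> ?A. lt x y}" "x' \<in> {x \<in> ?A. lt x y}" "lt x x'" for x x'
        using that unfolding C_def seg_def by blast
    qed auto
    moreover have "|{x \<in> ?A. lt y x}| \<le>o \<mu>"
    proof -
      interpret dual: strict_linear_order S "\<lambda>x y. lt y x" by (rule dual)
      have dual_between: "dual.between p q = between q p" for p q
        unfolding between_def dual.between_def by blast
      show ?thesis
      proof (rule dual.card_chain_le[OF _ wo y])
        show "|I| \<le>o \<mu>" if "I \<subseteq> S" "\<And>i. i \<in> I \<Longrightarrow> P i \<in> S \<and> Q i \<in> S \<and> lt (Q i) (P i)"
          "disjoint_family_on (\<lambda>i. dual.between (P i) (Q i)) I" for I P Q
          using cell[of I Q P] that unfolding dual_between by blast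
        show "(x, x') \<in> r" if "x \<in> {x \<in> ?A. lt y x}" "x' \<in> {x \<in> ?A. lt y x}" "lt x' x" for x x'
          using that unfolding C_def seg_def by blast
      qed auto
    qed
    moreover have "?A = {x \<in> ?A. lt x y} \<union> {x \<in> ?A. lt y x}"
      using total y by blast
    ultimately show ?thesis
      using card_of_Un_ordLeq_infinite_Field[of \<mu>] \<mu> unfolding cinfinite_def by (metis (lifting))
  qed
  \<comment> \<open>\<open>R\<close> is the proper ancestor relation of the tree.\<close>
  define R where "R = {(x, y). x \<in> S \<and> y \<in> S \<and> x \<noteq> y \<and> (x, y) \<in> r \<and> y \<in> C x}"
  have "wf R"
    by (rule wf_subset[OF wfr]) (auto simp: R_def)
  moreover have "|{x. (x, y) \<in> R}| <o |Field (cardSuc \<mu>)|" for y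
  proof (cases "y \<in> S")
    case True
    have "|{x. (x, y) \<in> R}| \<le>o |{x \<in> S. x \<noteq> y \<and> y \<in> C x}|"
      by (rule card_of_mono1) (auto simp: R_def)
    also have "|{x \<in> S. x \<noteq> y \<and> y \<in> C x}| \<le>o \<mu>" by (rule few[OF True])
    also have "\<mu> <o cardSuc \<mu>" using \<mu> cardSuc_greater by blast
    also have "cardSuc \<mu> =o |Field (cardSuc \<mu>)|"
      using \<mu> by (simp add: ordIso_symmetric[OF card_of_Field_ordIso] cardSuc_Card_order)
    finally show ?thesis .
  next
    case False
    then have "|{x. (x, y) \<in> R}| <o natLeq"
      unfolding finite_iff_ordLess_natLeq[symmetric] by (simp add: R_def)
    moreover have "natLeq \<le>o |Field (cardSuc \<mu>)|"
      using Cinfinite_cardSuc[OF \<mu>] infinite_iff_natLeq_ordLeq unfolding cinfinite_def by blast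
    ultimately show ?thesis by (rule ordLess_ordLeq_trans)
  qed
  ultimately obtain h where h: "\<And>x. h x \<in> Field (cardSuc \<mu>)" "\<And>x y. (x, y) \<in> R \<Longrightarrow> h x \<noteq> h y"
    using greedy_colouring by metis
  have colour_class: "|{x \<in> D. h x = c}| \<le>o \<mu>" for c
  proof -
    have "\<forall>x \<in> D. \<exists>p q. p \<in> S \<and> q \<in> S \<and> lt p q \<and> between p q \<subseteq> C x"
      unfolding D_def using trans by blast
    then obtain P Q where PQ: "\<And>x. x \<in> D \<Longrightarrow> P x \<in> S \<and> Q x \<in> S \<and> lt (P x) (Q x) \<and> between (P x) (Q x) \<subseteq> C x"
      by metis
    have "C x \<inter> C y = {}" if "x \<in> D" "y \<in> D" "h x = h y" "x \<noteq> y" for x y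
      using nested[of x y] nested[of y x] h(2)[of x y] h(2)[of y x] that total_r[of x y]
      unfolding R_def D_def by auto
    then have "disjoint_family_on (\<lambda>x. between (P x) (Q x)) {x \<in> D. h x = c}"
      unfolding disjoint_family_on_def using PQ by blast
    then show ?thesis
      using PQ by (intro cell[of _ P Q]) (auto simp: D_def)
  qed
  have "|\<Union>c \<in> Field (cardSuc \<mu>). {x \<in> D. h x = c}| \<le>o cardSuc \<mu>"
  proof (rule card_of_UNION_ordLeq_infinite_Field)
    show "infinite (Field (cardSuc \<mu>))" "Card_order (cardSuc \<mu>)"
      using Cinfinite_cardSuc[OF \<mu>] unfolding cinfinite_def by auto
    show "|Field (cardSuc \<mu>)| \<le>o cardSuc \<mu>"
      using \<mu> by (intro ordIso_imp_ordLeq card_of_Field_ordIso cardSuc_Card_order) simp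
    show "\<forall>c \<in> Field (cardSuc \<mu>). |{x \<in> D. h x = c}| \<le>o cardSuc \<mu>"
      using ordLeq_transitive[OF colour_class cardSuc_ordLeq] \<mu> by simp
  qed
  moreover have "(\<Union>c \<in> Field (cardSuc \<mu>). {x \<in> D. h x = c}) = D"
    using h(1) by blast
  ultimately have "|D| \<le>o cardSuc \<mu>" by simp
  moreover have "D \<subseteq> S" by (auto simp: D_def)
  ultimately show ?thesis using that[of D] meets by simp
qed

section \<open>Order topologies without isolated points\<close>

locale ordered_space =
  fixes A :: "'a set" and r :: "'a rel"
  assumes linear: "linear_order_on A r"
begin

abbreviation X :: "'a topology" where
  "X \<equiv> order_topology_on A r"

definition lt :: "'a \<Rightarrow> 'a \<Rightarrow> bool" where
  "lt x y \<longleftrightarrow> (x, y) \<in> r \<and> x \<noteq> y"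

lemma antisym_r: "antisym r" and trans_r: "trans r" and total_r: "total_on A r"
  using linear by (auto simp: order_on_defs)

sublocale strict_linear_order A lt
proof
  show "lt x z" if "lt x y" "lt y z" for x y z
    using that antisymD[OF antisym_r] transD[OF trans_r] unfolding lt_def by metis
  show "lt x y \<or> lt y x" if "x \<in> A" "y \<in> A" "x \<noteq> y" for x y
    using that total_r unfolding lt_def total_on_def by blast
qed (simp add: lt_def)

lemma asym: "lt x y \<Longrightarrow> \<not> lt y x"
  using irrefl trans by blast

lemma openin_X:
  "openin X = generate_topology_on
     (insert A ((\<lambda>a. {x \<in> A. lt x a}) ` A \<union> (\<lambda>a. {x \<in> A. lt a x}) ` A))"
proof -
  have "(x, a) \<in> r \<and> x \<noteq> a \<longleftrightarrow> lt x a" "(a, x) \<in> r \<and> x \<noteq> a \<longleftrightarrow> lt a x" for x a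
    by (auto simp: lt_def)
  then show ?thesis
    unfolding order_topology_on_def by (auto simp: openin_topology_generated_by_iff fun_eq_iff)
qed

lemma openin_less: "a \<in> A \<Longrightarrow> openin X {x \<in> A. lt x a}"
  and openin_greater: "a \<in> A \<Longrightarrow> openin X {x \<in> A. lt a x}"
  unfolding openin_X by (rule generate_topology_on.Basis; blast)+

lemma openin_between:
  assumes "p \<in> A" "q \<in> A"
  shows "openin X (between p q)"
proof -
  have "between p q = {x \<in> A. lt p x} \<inter> {x \<in> A. lt x q}"
    by (auto simp: between_def)
  then show ?thesis
    using openin_greater[OF assms(1)] openin_less[OF assms(2)] by auto
qed

lemma Hausdorff: "Hausdorff_space X"
proof -
  have "\<exists>U V. openin X U \<and> openin X V \<and> x \<in> U \<and> y \<in> V \<and> disjnt U V"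
    if xy: "x \<in> A" "y \<in> A" "lt x y" for x y
  proof (cases "between x y = {}")
    case True
    have "disjnt {z \<in> A. lt z y} {z \<in> A. lt x z}"
      using True unfolding between_def disjnt_iff by blast
    then show ?thesis
      using openin_less openin_greater xy by blast
  next
    case False
    then obtain z where z: "z \<in> A" "lt x z" "lt z y"
      unfolding between_def by blast
    then have "disjnt {w \<in> A. lt w z} {w \<in> A. lt z w}"
      using asym unfolding disjnt_iff by blast
    then show ?thesis
      using openin_less[OF z(1)] openin_greater[OF z(1)] xy z by blast
  qed
  then have "\<exists>U V. openin X U \<and> openin X V \<and> x \<in> U \<and> y \<in> V \<and> disjnt U V"
    if "x \<in> A" "y \<in> A" "x \<noteq> y" for x y
    using total[OF that] that by (meson disjnt_sym)
  then show ?thesis unfolding Hausdorff_space_def by simp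
qed

text \<open>
  Only points with points on both sides have a neighbourhood base of bounded intervals; the endpoints
  \<open>a\<close> and \<open>b\<close> replace the missing ends of open rays.
\<close>

lemma open_contains_between:
  assumes U: "openin X U" and "x \<in> U" and ab: "a \<in> A" "b \<in> A" "lt a x" "lt x b"
  obtains p q where "p \<in> A" "q \<in> A" "lt p x" "lt x q" "between p q \<subseteq> U"
proof -
  have "\<exists>p \<in> A. \<exists>q \<in> A. lt p x \<and> lt x q \<and> between p q \<subseteq> U"
    using U \<open>x \<in> U\<close> unfolding openin_X
  proof induction
    case (Int U V)
    then obtain p q p' q' where *: "p \<in> A" "q \<in> A" "lt p x" "lt x q" "between p q \<subseteq> U"
      "p' \<in> A" "q' \<in> A" "lt p' x" "lt x q'" "between p' q' \<subseteq> V"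
      by (meson IntD1 IntD2)
    have "\<exists>s \<in> A. lt s x \<and> (s = p \<or> lt p s) \<and> (s = p' \<or> lt p' s)"
      using * total by metis
    moreover have "\<exists>t \<in> A. lt x t \<and> (t = q \<or> lt t q) \<and> (t = q' \<or> lt t q')"
      using * total by metis
    ultimately obtain s t where st: "s \<in> A" "lt s x" "s = p \<or> lt p s" "s = p' \<or> lt p' s"
      "t \<in> A" "lt x t" "t = q \<or> lt t q" "t = q' \<or> lt t q'"
      by blast
    then have "between s t \<subseteq> between p q" "between s t \<subseteq> between p' q'"
      unfolding between_def using trans by blast+
    then show ?case using st * by blast
  next
    case (UN K)
    then show ?case by (meson Union_upper UnionE subset_trans)
  next
    case (Basis S)
    then consider "S = A" | c where "c \<in> A" "S = {x \<in> A. lt x c}" | c where "c \<in> A" "S = {x \<in> A. lt c x}"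
      by blast
    then show ?case
    proof cases
      case 1
      then show ?thesis using ab unfolding between_def by blast
    next
      case 2
      then have "between a c \<subseteq> S" "lt x c" using Basis unfolding between_def by blast+
      then show ?thesis using ab 2 by blast
    next
      case 3
      then have "between c b \<subseteq> S" "lt c x" using Basis unfolding between_def by blast+
      then show ?thesis using ab 3 by blast
    qed
  qed auto
  then show ?thesis using that by blast
qed

end

locale crowded_ordered_space = ordered_space +
  assumes crowded: "\<not> openin X {x}"
begin

text \<open>
  Without isolated points, a nonempty open set has at least three points, and the middle one of three
  points is not an endpoint of the order.
\<close>

lemma nonempty_open_contains_between:
  assumes U: "openin X U" "U \<noteq> {}"
  obtains p q where "p \<in> A" "q \<in> A" "between p q \<noteq> {}" "between p q \<subseteq> U"
proof -
  have UA: "U \<subseteq> A" using openin_subset[OF U(1)] by simp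
  obtain x where x: "x \<in> U" using U by blast
  have "U \<noteq> {x}" using crowded U by metis
  then obtain y where y: "y \<in> U" "y \<noteq> x" using x by blast
  have "openin X (U - {x})"
    using U(1) Hausdorff Hausdorff_imp_t1_space t1_space_openin_delete_alt by metis
  then have "U - {x} \<noteq> {y}" using crowded by metis
  then obtain z where z: "z \<in> U" "z \<noteq> x" "z \<noteq> y" using y by blast
  obtain a m b where m: "a \<in> U" "m \<in> U" "b \<in> U" "lt a m" "lt m b"
  proof -
    have "lt x y \<or> lt y x" "lt x z \<or> lt z x" "lt y z \<or> lt z y"
      using total[of x y] total[of x z] total[of y z] x y z UA by auto
    then show thesis using that x y(1) z(1) by metis
  qed
  obtain p q where "p \<in> A" "q \<in> A" "lt p m" "lt m q" "between p q \<subseteq> U"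
    using open_contains_between[OF U(1) m(2) _ _ m(4,5)] m UA by blast
  then show ?thesis using that[of p q] m UA unfolding between_def by blast
qed

text \<open>
  The order of a disconnected space may have jumps, so the dense order that Kurepa's inequality
  requires is obtained by keeping only the points without an immediate successor (among them the
  greatest point, if any).
\<close>

definition right_limits :: "'a set" where
  "right_limits = {x \<in> A. \<forall>q \<in> A. lt x q \<longrightarrow> between x q \<noteq> {}}"

text \<open>
  No point has both an immediate predecessor and an immediate successor, as it would be isolated.
  Thus the immediate successor of a point never has an immediate successor itself. To stay
  inside the given interval, start from a point \<open>w\<close> that is strictly below another point of
  the interval which is not the immediate successor of \<open>w\<close>.
\<close>

lemma right_limits_meet_between:
  assumes pq: "p \<in> A" "q \<in> A" "between p q \<noteq> {}"
  shows "right_limits \<inter> between p q \<noteq> {}"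
proof -
  have succ: "\<exists>y \<in> A. lt x y \<and> between x y = {}" if "x \<in> A" "x \<notin> right_limits" for x
    using that unfolding right_limits_def by blast
  have not_both: False if "x \<in> A" "y \<in> A" "z \<in> A" "lt x y" "lt y z" "between x y = {}" "between y z = {}" for x y z
  proof -
    have "between x z = {y}"
      using that total unfolding between_def by blast
    then show False using openin_between[of x z] crowded that by metis
  qed
  obtain x where x: "x \<in> A" "lt p x" "lt x q" using pq unfolding between_def by blast
  show ?thesis
  proof (cases "x \<in> right_limits")
    case True
    then show ?thesis using x unfolding between_def by blast
  next
    case False
    then obtain x' where x': "x' \<in> A" "lt x x'" "between x x' = {}"
      using succ x by blast
    then have "between p x \<noteq> {}" using not_both[of p x x'] x pq by blast
    then obtain w where w: "w \<in> A" "lt p w" "lt w x" unfolding between_def by blast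
    show ?thesis
    proof (cases "w \<in> right_limits")
      case True
      then show ?thesis using w x trans unfolding between_def by blast
    next
      case False
      then obtain w' where w': "w' \<in> A" "lt w w'" "between w w' = {}"
        using succ w by blast
      have "lt w' x"
        using not_both[of w x x'] w w' x x' total[of w' x] unfolding between_def by blast
      moreover have "w' \<in> right_limits"
        using not_both[of w w'] w w' unfolding right_limits_def by blast
      ultimately show ?thesis
        using w w' x trans unfolding between_def by blast
    qed
  qed
qed

text \<open>
  Kurepa's inequality, transferred from the dense order of the right limits in an interval to the
  topology. Intervals that are disjoint as sets of right limits are disjoint in the space, because
  every nonempty open set contains right limits.
\<close>

lemma interval_dense_subset_card_le:
  fixes \<mu> :: "'m rel"
  assumes U: "openin X U" "U \<noteq> {}" and \<mu>: "Cinfinite \<mu>"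
    and cell: "\<And>I G. \<lbrakk>I \<subseteq> A; \<And>i. i \<in> I \<Longrightarrow> openin X (G i) \<and> G i \<noteq> {} \<and> G i \<subseteq> U;
      disjoint_family_on G I\<rbrakk> \<Longrightarrow> |I| \<le>o \<mu>"
  obtains a b D where "a \<in> A" "b \<in> A" "between a b \<noteq> {}" "between a b \<subseteq> U"
    "D \<subseteq> between a b" "|D| \<le>o cardSuc \<mu>"
    "\<And>W. openin X W \<Longrightarrow> W \<noteq> {} \<Longrightarrow> W \<subseteq> between a b \<Longrightarrow> D \<inter> W \<noteq> {}"
proof -
  obtain a b where ab: "a \<in> A" "b \<in> A" "between a b \<noteq> {}" "between a b \<subseteq> U"
    using nonempty_open_contains_between[OF U] .
  define S where "S = right_limits \<inter> between a b"
  have S: "S \<subseteq> A" by (auto simp: S_def between_def)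
  interpret S: strict_linear_order S lt
  proof
    show "lt x y \<or> lt y x" if "x \<in> S" "y \<in> S" "x \<noteq> y" for x y
      using total[of x y] that S by auto
  qed (fact irrefl, fact trans)
  have meets: "S \<inter> between p q \<noteq> {}"
    if "p \<in> A" "q \<in> A" "between p q \<noteq> {}" "between p q \<subseteq> between a b" for p q
    using right_limits_meet_between[OF that(1-3)] that(4) unfolding S_def by blast
  have sub: "between p q \<subseteq> between a b" if "p \<in> between a b" "q \<in> between a b" for p q
    using that trans unfolding between_def by blast
  have S_between: "S.between p q = S \<inter> between p q" for p q
    using S unfolding S.between_def between_def by blast
  have nonempty: "between p q \<noteq> {}" if "p \<in> S" "q \<in> A" "lt p q" for p q
    using that unfolding S_def right_limits_def by blast
  have S_dense: "S.between p q \<noteq> {}" if pq: "p \<in> S" "q \<in> S" "lt p q" for p q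
  proof -
    have "p \<in> A" "q \<in> A" "between p q \<subseteq> between a b"
      using sub pq S unfolding S_def by auto
    with meets[OF this(1,2) nonempty this(3)] show ?thesis
      using pq unfolding S_between by blast
  qed
  have S_cell: "|I| \<le>o \<mu>" if I: "I \<subseteq> S" and PQ: "\<And>i. i \<in> I \<Longrightarrow> P i \<in> S \<and> Q i \<in> S \<and> lt (P i) (Q i)"
      and disj: "disjoint_family_on (\<lambda>i. S.between (P i) (Q i)) I" for I P Q
  proof (rule cell[of I "\<lambda>i. between (P i) (Q i)"])
    show "I \<subseteq> A" using I S by blast
    show "openin X (between (P i) (Q i)) \<and> between (P i) (Q i) \<noteq> {} \<and> between (P i) (Q i) \<subseteq> U" if "i \<in> I" for i
    proof -
      have i: "P i \<in> S" "Q i \<in> S" "lt (P i) (Q i)" using PQ[OF that] by auto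
      then have "P i \<in> A" "Q i \<in> A" using S by auto
      moreover have "between (P i) (Q i) \<subseteq> U"
        using sub[of "P i" "Q i"] i ab(4) unfolding S_def by auto
      ultimately show ?thesis using openin_between nonempty i by simp
    qed
    show "disjoint_family_on (\<lambda>i. between (P i) (Q i)) I"
      unfolding disjoint_family_on_def
    proof (intro ballI impI)
      fix i j assume ij: "i \<in> I" "j \<in> I" "i \<noteq> j"
      let ?W = "between (P i) (Q i) \<inter> between (P j) (Q j)"
      have i: "P i \<in> S" "Q i \<in> S" using PQ[OF ij(1)] by auto
      have j: "P j \<in> A" "Q j \<in> A" using PQ[OF ij(2)] S by auto
      have Wo: "openin X ?W" using openin_between i j S by (intro openin_Int) auto
      have Ws: "?W \<subseteq> between a b" using sub[of "P i" "Q i"] i unfolding S_def by auto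
      have SW: "S \<inter> ?W = {}"
        using disj ij unfolding disjoint_family_on_def S_between by blast
      show "?W = {}"
      proof (rule ccontr)
        assume "?W \<noteq> {}"
        from nonempty_open_contains_between[OF Wo this]
        obtain p q where "p \<in> A" "q \<in> A" "between p q \<noteq> {}" "between p q \<subseteq> ?W" .
        then show False using meets[of p q] Ws SW by blast
      qed
    qed
  qed
  obtain D where D: "D \<subseteq> S" "|D| \<le>o cardSuc \<mu>"
    "\<And>p q. p \<in> S \<Longrightarrow> q \<in> S \<Longrightarrow> lt p q \<Longrightarrow> D \<inter> S.between p q \<noteq> {}"
  proof (rule S.dense_subset_card_le_cardSuc_cellularity[OF _ \<mu>])
    show "S.between p q \<noteq> {}" if "p \<in> S" "q \<in> S" "lt p q" for p q
      by (rule S_dense[OF that])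
    show "|I| \<le>o \<mu>" if "I \<subseteq> S" "\<And>i. i \<in> I \<Longrightarrow> P i \<in> S \<and> Q i \<in> S \<and> lt (P i) (Q i)"
      "disjoint_family_on (\<lambda>i. S.between (P i) (Q i)) I" for I P Q
      by (rule S_cell[OF that])
  qed (rule that)
  have "D \<inter> W \<noteq> {}" if W: "openin X W" "W \<noteq> {}" "W \<subseteq> between a b" for W
  proof -
    obtain p q where pq: "p \<in> A" "q \<in> A" "between p q \<noteq> {}" "between p q \<subseteq> W"
      using nonempty_open_contains_between[OF W(1,2)] .
    then obtain s where s: "s \<in> S" "s \<in> between p q" using meets[of p q] W by blast
    then have "between s q \<noteq> {}" "between s q \<subseteq> between p q" "s \<in> A"
      using nonempty pq trans S unfolding between_def by blast+
    then obtain t where t: "t \<in> S" "t \<in> between s q" using meets[of s q] W pq by blast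
    then have "D \<inter> S.between s t \<noteq> {}" using D(3) s unfolding between_def by blast
    moreover have "S.between s t \<subseteq> between p q"
      using s t trans unfolding S_between between_def by blast
    ultimately show ?thesis using pq by blast
  qed
  moreover have "D \<subseteq> between a b" using D S_def by blast
  ultimately show ?thesis using that[of a b D] ab D(2) by blast
qed

end

section \<open>Size bounds for compact and Hausdorff spaces\<close>

text \<open>
  By regularity, the pieces \<open>G i\<close> of an open set can be shrunk so that their closures stay inside that
  set. Following a sequence \<open>f\<close> through the tree of pieces gives decreasing closed sets, and
  compactness provides a point in all of them. Two sequences that differ are separated at
  the first place where they differ.
\<close>

lemma nat_sequences_le_compact_Hausdorff:
  fixes I :: "'i set"
  assumes X: "compact_space X" "Hausdorff_space X" "topspace X \<noteq> {}"
    and split: "\<And>U. openin X U \<Longrightarrow> U \<noteq> {} \<Longrightarrow>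
      \<exists>G. (\<forall>i \<in> I. openin X (G i) \<and> G i \<noteq> {} \<and> G i \<subseteq> U) \<and> disjoint_family_on G I"
  shows "|Func (UNIV :: nat set) I| \<le>o |topspace X|"
proof -
  have reg: "regular_space X" using X compact_Hausdorff_imp_regular_space by blast
  have shrink: "\<exists>V. openin X V \<and> V \<noteq> {} \<and> X closure_of V \<subseteq> U" if U: "openin X U" "U \<noteq> {}" for U
  proof -
    obtain x where x: "x \<in> U" using U by blast
    have xt: "x \<in> topspace X" using U x openin_subset by blast
    have "closedin X (topspace X - U)" "x \<in> topspace X - (topspace X - U)"
      using U x xt by auto
    then obtain V where V: "openin X V" "x \<in> V" "disjnt (topspace X - U) (X closure_of V)"
      using reg unfolding regular_space by blast
    then have "X closure_of V \<subseteq> U"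
      using closure_of_subset_topspace[of X V] unfolding disjnt_iff by blast
    then show ?thesis using V by blast
  qed
  have "\<exists>G. (\<forall>i \<in> I. openin X (G i) \<and> G i \<noteq> {} \<and> X closure_of G i \<subseteq> U) \<and> disjoint_family_on G I"
    if U: "openin X U" "U \<noteq> {}" for U
  proof -
    obtain G where G: "\<And>i. i \<in> I \<Longrightarrow> openin X (G i) \<and> G i \<noteq> {} \<and> G i \<subseteq> U" "disjoint_family_on G I"
      using split[OF U] by blast
    then have "\<forall>i \<in> I. \<exists>V. openin X V \<and> V \<noteq> {} \<and> X closure_of V \<subseteq> G i"
      using shrink by blast
    then obtain V where V: "\<And>i. i \<in> I \<Longrightarrow> openin X (V i) \<and> V i \<noteq> {} \<and> X closure_of V i \<subseteq> G i"
      by metis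
    then have VG: "V i \<subseteq> G i" if "i \<in> I" for i
      using closure_of_subset openin_subset that by (metis order_trans)
    then have "disjoint_family_on V I"
      using G(2) unfolding disjoint_family_on_def by blast
    then show ?thesis using V G(1) by (meson order_trans)
  qed
  then obtain G where G: "\<And>U i. openin X U \<Longrightarrow> U \<noteq> {} \<Longrightarrow> i \<in> I \<Longrightarrow>
      openin X (G U i) \<and> G U i \<noteq> {} \<and> X closure_of G U i \<subseteq> U"
    "\<And>U. openin X U \<Longrightarrow> U \<noteq> {} \<Longrightarrow> disjoint_family_on (G U) I"
    by metis
  define T where "T f = rec_nat (topspace X) (\<lambda>n U. G U (f n))" for f
  have T_simps: "T f 0 = topspace X" "T f (Suc n) = G (T f n) (f n)" for f n
    by (simp_all add: T_def)
  define \<F> where "\<F> = Func (UNIV :: nat set) I"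
  have \<F>: "f n \<in> I" if "f \<in> \<F>" for f n using that by (auto simp: \<F>_def Func_def)
  have T: "openin X (T f n) \<and> T f n \<noteq> {}" if "f \<in> \<F>" for f n
    by (induction n) (use X(3) G(1) \<F>[OF that] in \<open>auto simp: T_simps\<close>)
  have T_closure: "X closure_of T f (Suc n) \<subseteq> T f n" if "f \<in> \<F>" for f n
    using G(1) T[OF that] \<F>[OF that] by (auto simp: T_simps)
  have T_subset: "T f n \<subseteq> X closure_of T f n" if "f \<in> \<F>" for f n
    using T[OF that] by (simp add: closure_of_subset openin_subset)
  have "(\<Inter>n. X closure_of T f n) \<noteq> {}" if f: "f \<in> \<F>" for f
  proof (rule compact_space_imp_nest[OF X(1)])
    show "X closure_of T f n \<noteq> {}" for n
      using T[OF f, of n] T_subset[OF f, of n] by blast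
    show "decseq (\<lambda>n. X closure_of T f n)"
      using T_closure[OF f] T_subset[OF f] by (intro decseq_SucI) blast
  qed auto
  then have "\<forall>f \<in> \<F>. \<exists>x. \<forall>n. x \<in> X closure_of T f n"
    by (auto simp: ex_in_conv[symmetric] simp del: ex_in_conv)
  then obtain x where x: "\<And>f n. f \<in> \<F> \<Longrightarrow> x f \<in> X closure_of T f n"
    using bchoice[of \<F> "\<lambda>f x. \<forall>n. x \<in> X closure_of T f n"] by blast
  then have xT: "x f \<in> T f n" if "f \<in> \<F>" for f n
    using T_closure[OF that] that by blast
  have "inj_on x \<F>"
  proof (rule inj_onI)
    fix f g assume f: "f \<in> \<F>" and g: "g \<in> \<F>" and eq: "x f = x g"
    have "T f n = T g n \<and> (\<forall>m < n. f m = g m)" for n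
    proof (induction n)
      case (Suc n)
      have "x f \<in> G (T f n) (f n) \<inter> G (T f n) (g n)"
        using xT[OF f, of "Suc n"] xT[OF g, of "Suc n"] eq Suc by (simp add: T_simps)
      then have "f n = g n"
        using G(2)[of "T f n"] T[OF f] \<F> f g unfolding disjoint_family_on_def by blast
      then show ?case using Suc by (auto simp: T_simps less_Suc_eq)
    qed (simp add: T_simps)
    then show "f = g" by blast
  qed
  moreover have "x ` \<F> \<subseteq> topspace X"
    using xT[of _ 0] by (auto simp: T_simps)
  ultimately show ?thesis unfolding \<F>_def card_of_ordLeq[symmetric] by blast
qed

text \<open>
  In a Hausdorff space a point is determined by the traces of its neighbourhoods on a dense set.
\<close>

lemma card_le_Pow_Pow_dense:
  assumes "Hausdorff_space X" "openin X V"
    and dense: "\<And>W. openin X W \<Longrightarrow> W \<noteq> {} \<Longrightarrow> W \<subseteq> V \<Longrightarrow> D \<inter> W \<noteq> {}"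
  shows "|V| \<le>o |Pow (Pow D)|"
proof -
  define t where "t x = {D \<inter> W |W. openin X W \<and> x \<in> W \<and> W \<subseteq> V}" for x
  have "inj_on t V"
  proof (rule inj_onI, rule ccontr)
    fix x y assume x: "x \<in> V" and y: "y \<in> V" and eq: "t x = t y" and "x \<noteq> y"
    then have "x \<in> topspace X" "y \<in> topspace X"
      using openin_subset[OF assms(2)] by auto
    then obtain U U' where U: "openin X U" "openin X U'" "x \<in> U" "y \<in> U'" "disjnt U U'"
      using assms(1) \<open>x \<noteq> y\<close> unfolding Hausdorff_space_def by metis
    have "D \<inter> (U \<inter> V) \<in> t x"
      unfolding t_def using U x assms(2) by blast
    then obtain W where W: "openin X W" "y \<in> W" "W \<subseteq> V" "D \<inter> (U \<inter> V) = D \<inter> W"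
      unfolding eq unfolding t_def by blast
    have "D \<inter> (W \<inter> U') \<noteq> {}"
      using W U by (intro dense) auto
    then show False using W U unfolding disjnt_iff by blast
  qed
  moreover have "t ` V \<subseteq> Pow (Pow D)" by (auto simp: t_def)
  ultimately show ?thesis unfolding card_of_ordLeq[symmetric] by blast
qed

section \<open>Singular cardinals and strong limits\<close>

lemma card_of_Times_ordLess_Cinfinite:
  assumes \<kappa>: "Cinfinite \<kappa>" and A: "|A| <o \<kappa>" and B: "|B| <o \<kappa>"
  shows "|A \<times> B| <o \<kappa>"
proof (cases "finite (A <+> B)")
  case True
  then have "finite (A \<times> B)" by simp
  then show ?thesis
    using finite_iff_ordLess_natLeq natLeq_ordLeq_cinfinite[OF \<kappa>] ordLess_ordLeq_trans by blast
next
  case False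
  have "|A \<times> B| \<le>o |(A <+> B) \<times> (A <+> B)|"
    using card_of_Times_mono1[OF card_of_Plus1] card_of_Times_mono2[OF card_of_Plus2]
      ordLeq_transitive by blast
  also have "|(A <+> B) \<times> (A <+> B)| =o |A <+> B|"
    using False by (rule card_of_Times_same_infinite)
  also have "|A <+> B| <o \<kappa>"
    using \<kappa> A B by (intro card_of_Plus_ordLess_infinite_Field) (auto simp: cinfinite_def)
  finally show ?thesis .
qed

lemma card_of_Pow_ordLess_strong_limit:
  fixes \<kappa> :: "'k rel"
  assumes "strong_limit \<kappa>" "Card_order \<kappa>" "|B| <o \<kappa>"
  shows "|Pow B| <o \<kappa>"
proof -
  have "|Pow B| =o ctwo ^c |B|"
    unfolding ctwo_def cexp_def Field_card_of by (rule card_of_Pow_Func)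
  then show ?thesis
    using strong_limitD[OF assms(1,2) card_of_Card_order assms(3)] ordIso_ordLess_trans by blast
qed

text \<open>
  As \<open>\<kappa>\<close> is regular and uncountable, every sequence in \<open>\<kappa>\<close> is bounded, so the sequences form a union of \<open>\<kappa>\<close> many sets, each
  consisting of the sequences below one bound; such a set has size less than \<open>\<kappa>\<close> because \<open>\<kappa>\<close> is an uncountable strong limit.
\<close>

lemma regular_strong_limit_cexp_natLeq:
  fixes \<kappa> :: "'k rel"
  assumes \<kappa>: "Cinfinite \<kappa>" "strong_limit \<kappa>" "regularCard \<kappa>" and unc: "natLeq <o \<kappa>"
  shows "\<kappa> ^c natLeq \<le>o \<kappa>"
proof -
  have wo: "Well_order \<kappa>" using \<kappa> card_order_on_well_order_on by blast
  then have total: "(a, b) \<in> \<kappa> \<or> (b, a) \<in> \<kappa>" if "a \<in> Field \<kappa>" "b \<in> Field \<kappa>" for a b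
    using that unfolding order_on_defs total_on_def refl_on_def by metis
  have inf: "infinite (Field \<kappa>)" using \<kappa> by (simp add: cinfinite_def)
  have nat: "|UNIV :: nat set| <o \<kappa>"
    using unc card_of_nat ordIso_ordLess_trans by blast
  let ?B = "\<lambda>a. insert a (underS \<kappa> a)"
  have bounded: "\<exists>a \<in> Field \<kappa>. range f \<subseteq> ?B a" if f: "range f \<subseteq> Field \<kappa>" for f :: "nat \<Rightarrow> 'k"
  proof -
    have "\<not> |range f| =o \<kappa>"
      using card_of_image[of f UNIV] nat ordLeq_ordLess_trans not_ordLess_ordIso by blast
    then have "\<not> cofinal (range f) \<kappa>"
      using \<kappa>(3) f unfolding regularCard_def by blast
    then obtain a where a: "a \<in> Field \<kappa>" "\<And>b. b \<in> range f \<Longrightarrow> a = b \<or> (a, b) \<notin> \<kappa>"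
      unfolding cofinal_def by blast
    then have "range f \<subseteq> ?B a"
      using total f unfolding underS_def by blast
    then show ?thesis using a by blast
  qed
  have small: "|Func (UNIV :: nat set) (?B a)| \<le>o \<kappa>" if a: "a \<in> Field \<kappa>" for a
  proof -
    have "|{a}| <o \<kappa>"
      using unc finite_iff_ordLess_natLeq[of "{a}"] ordLess_transitive by blast
    then have "|{a} \<union> underS \<kappa> a| <o \<kappa>"
      using card_of_underS[of \<kappa> a] a \<kappa> inf by (intro card_of_Un_ordLess_infinite_Field) auto
    then have "|(UNIV :: nat set) \<times> ?B a| <o \<kappa>"
      using nat \<kappa> by (intro card_of_Times_ordLess_Cinfinite) auto
    then have "|Pow ((UNIV :: nat set) \<times> ?B a)| <o \<kappa>"
      using card_of_Pow_ordLess_strong_limit \<kappa> by blast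
    moreover have "|Func (UNIV :: nat set) (?B a)| \<le>o |Pow ((UNIV :: nat set) \<times> ?B a)|"
    proof -
      have "inj (\<lambda>f :: nat \<Rightarrow> 'k. {(n, f n) |n. True})"
        by (rule injI) (auto simp: set_eq_iff fun_eq_iff)
      then have "inj_on (\<lambda>f. {(n, f n) |n. True}) (Func (UNIV :: nat set) (?B a))"
        using inj_on_subset by blast
      moreover have "(\<lambda>f. {(n, f n) |n. True}) ` Func (UNIV :: nat set) (?B a) \<subseteq> Pow (UNIV \<times> ?B a)"
        unfolding Func_def by blast
      ultimately show ?thesis unfolding card_of_ordLeq[symmetric] by blast
    qed
    ultimately show ?thesis
      using ordLeq_ordLess_trans ordLess_imp_ordLeq by blast
  qed
  have "Func UNIV (Field \<kappa>) \<subseteq> (\<Union>a \<in> Field \<kappa>. Func (UNIV :: nat set) (?B a))"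
  proof
    fix f assume "f \<in> Func (UNIV :: nat set) (Field \<kappa>)"
    then have "range f \<subseteq> Field \<kappa>" by (auto simp: Func_def)
    from bounded[OF this] show "f \<in> (\<Union>a \<in> Field \<kappa>. Func UNIV (?B a))"
      by (auto simp: Func_def)
  qed
  then have "|Func (UNIV :: nat set) (Field \<kappa>)| \<le>o |\<Union>a \<in> Field \<kappa>. Func (UNIV :: nat set) (?B a)|"
    by (rule card_of_mono1)
  moreover have "|\<Union>a \<in> Field \<kappa>. Func (UNIV :: nat set) (?B a)| \<le>o \<kappa>"
  proof (rule card_of_UNION_ordLeq_infinite_Field[OF inf])
    show "Card_order \<kappa>" using \<kappa> by simp
    then show "|Field \<kappa>| \<le>o \<kappa>"
      using card_of_Field_ordIso ordIso_iff_ordLeq by blast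
    show "\<forall>a \<in> Field \<kappa>. |Func (UNIV :: nat set) (?B a)| \<le>o \<kappa>"
      using small by simp
  qed
  ultimately show ?thesis
    unfolding cexp_def Field_natLeq using ordLeq_transitive by blast
qed

lemma singular_gt_natLeq:
  assumes "Cinfinite \<kappa>" "\<not> regularCard \<kappa>"
  shows "natLeq <o \<kappa>"
  using assms natLeq_ordLeq_cinfinite regularCard_natLeq regularCard_ordIso natLeq_Cinfinite
    ordLeq_iff_ordLess_or_ordIso by blast

text \<open>
  Infinite successor cardinals are regular.
\<close>

lemma singular_imp_limit:
  assumes "Cinfinite \<kappa>" "\<not> regularCard \<kappa>" "Cinfinite \<mu>" "\<mu> <o \<kappa>"
  shows "cardSuc \<mu> <o \<kappa>"
proof -
  have "cardSuc \<mu> \<le>o \<kappa>"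
    using assms cardSuc_ordLess_ordLeq by blast
  then show ?thesis
    using assms regularCard_cardSuc regularCard_ordIso Cinfinite_cardSuc
      ordLeq_iff_ordLess_or_ordIso by blast
qed

section \<open>Splitting open sets into singularly many pieces\<close>

context crowded_ordered_space
begin

definition dense_in_interval :: "'a set \<Rightarrow> 'a \<Rightarrow> 'a \<Rightarrow> bool" where
  "dense_in_interval D a b \<longleftrightarrow> D \<subseteq> between a b \<and>
     (\<forall>W. openin X W \<and> W \<noteq> {} \<and> W \<subseteq> between a b \<longrightarrow> D \<inter> W \<noteq> {})"

definition disjoint_open_family :: "'i set \<Rightarrow> 'a set \<Rightarrow> ('i \<Rightarrow> 'a set) \<Rightarrow> bool" where
  "disjoint_open_family I U G \<longleftrightarrow>
     (\<forall>i \<in> I. openin X (G i) \<and> G i \<noteq> {} \<and> G i \<subseteq> U) \<and> disjoint_family_on G I"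

text \<open>
  If \<open>U\<close> could not be split into \<open>|I|\<close> pieces, all disjoint families of open sets in \<open>U\<close> would have
  size at most \<open>|I|\<close>, and Kurepa's inequality would give a dense subset of size less than \<open>\<kappa>\<close> in some
  interval. Adding \<open>\<aleph>\<^sub>0\<close> to \<open>|I|\<close> makes the cardinal infinite.
\<close>

lemma small_disjoint_open_family:
  fixes \<kappa> :: "'k rel" and I :: "'i set"
  assumes \<kappa>: "Cinfinite \<kappa>" "\<not> regularCard \<kappa>"
    and large: "\<forall>a \<in> A. \<forall>b \<in> A. \<forall>D. between a b \<noteq> {} \<and> dense_in_interval D a b \<longrightarrow> \<not> |D| <o \<kappa>"
    and U: "openin X U" "U \<noteq> {}" and I: "|I| <o \<kappa>"
  shows "\<exists>G. disjoint_open_family I U G"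
proof (rule ccontr)
  assume none: "\<nexists>G. disjoint_open_family I U G"
  define \<mu> where "\<mu> = |I <+> (UNIV :: nat set)|"
  have \<mu>_inf: "Cinfinite \<mu>"
    unfolding \<mu>_def cinfinite_def by (simp add: card_of_card_order_on Field_card_of)
  have nat: "|UNIV :: nat set| <o \<kappa>"
    by (rule ordIso_ordLess_trans[OF card_of_nat singular_gt_natLeq[OF \<kappa>]])
  have "\<mu> <o \<kappa>"
    unfolding \<mu>_def by (rule card_of_Plus_ordLess_infinite_Field[OF _ _ I nat])
      (use \<kappa> in \<open>auto simp: cinfinite_def\<close>)
  have cell: "|J| \<le>o \<mu>"
    if J: "\<And>i. i \<in> J \<Longrightarrow> openin X (G i) \<and> G i \<noteq> {} \<and> G i \<subseteq> U" "disjoint_family_on G J"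
    for J :: "'a set" and G
  proof -
    have "\<not> |I| \<le>o |J|"
    proof
      assume "|I| \<le>o |J|"
      then obtain f where f: "inj_on f I" "f ` I \<subseteq> J"
        unfolding card_of_ordLeq[symmetric] by blast
      then have "disjoint_open_family I U (\<lambda>i. G (f i))"
        using J unfolding disjoint_open_family_def disjoint_family_on_def
        by (auto simp: image_subset_iff inj_on_eq_iff)
      then show False using none by blast
    qed
    then have "|J| \<le>o |I|"
      using ordLeq_total[OF card_of_Well_order card_of_Well_order] by blast
    then show ?thesis
      unfolding \<mu>_def by (rule ordLeq_transitive[OF _ card_of_Plus1])
  qed
  obtain a b D where D: "a \<in> A" "b \<in> A" "between a b \<noteq> {}" "D \<subseteq> between a b" "|D| \<le>o cardSuc \<mu>"
    "\<And>W. openin X W \<Longrightarrow> W \<noteq> {} \<Longrightarrow> W \<subseteq> between a b \<Longrightarrow> D \<inter> W \<noteq> {}"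
  proof (rule interval_dense_subset_card_le[OF U \<mu>_inf])
    show "|J| \<le>o \<mu>" if "J \<subseteq> A" "\<And>i. i \<in> J \<Longrightarrow> openin X (G i) \<and> G i \<noteq> {} \<and> G i \<subseteq> U"
      "disjoint_family_on G J" for J and G :: "'a \<Rightarrow> 'a set"
      by (rule cell[OF that(2,3)])
  qed (rule that)
  have "|D| <o \<kappa>"
    by (rule ordLeq_ordLess_trans[OF D(5) singular_imp_limit[OF \<kappa> \<mu>_inf \<open>\<mu> <o \<kappa>\<close>]])
  moreover have "dense_in_interval D a b"
    using D(4,6) unfolding dense_in_interval_def by blast
  ultimately show False using large D(1-3) by blast
qed

text \<open>
  Take a cofinal subset \<open>K\<close> of \<open>\<kappa>\<close> with fewer than \<open>\<kappa>\<close> elements, split \<open>U\<close> into pieces \<open>G k\<close> for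
  \<open>k \<in> K\<close>, and split \<open>G k\<close> into pieces indexed by the elements below \<open>k\<close>. Every element \<open>i\<close> of \<open>\<kappa>\<close>
  lies below some \<open>k i \<in> K\<close> and thereby indexes a piece of \<open>G (k i)\<close>.
\<close>

lemma singular_disjoint_open_family:
  fixes \<kappa> :: "'k rel"
  assumes \<kappa>: "Cinfinite \<kappa>" "\<not> regularCard \<kappa>"
    and large: "\<forall>a \<in> A. \<forall>b \<in> A. \<forall>D. between a b \<noteq> {} \<and> dense_in_interval D a b \<longrightarrow> \<not> |D| <o \<kappa>"
    and U: "openin X U" "U \<noteq> {}"
  shows "\<exists>G. disjoint_open_family (Field \<kappa>) U G"
proof -
  obtain K where K: "K \<subseteq> Field \<kappa>" "cofinal K \<kappa>" "\<not> |K| =o \<kappa>"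
    using \<kappa>(2) unfolding regularCard_def by blast
  have "|K| \<le>o \<kappa>"
    using ordLeq_ordIso_trans[OF card_of_mono1[OF K(1)] card_of_Field_ordIso] \<kappa>(1) by simp
  then have "|K| <o \<kappa>" using K(3) ordLeq_iff_ordLess_or_ordIso by blast
  note split = small_disjoint_open_family[OF \<kappa> large]
  obtain G where G: "disjoint_open_family K U G"
    using split[OF U \<open>|K| <o \<kappa>\<close>] by blast
  have "\<exists>H. disjoint_open_family (underS \<kappa> k) (G k) H" if k: "k \<in> K" for k
  proof (rule split)
    show "|underS \<kappa> k| <o \<kappa>" using card_of_underS[of \<kappa> k] \<kappa>(1) K(1) k by blast
  qed (use G k in \<open>auto simp: disjoint_open_family_def\<close>)
  then obtain H where H: "\<And>k. k \<in> K \<Longrightarrow> disjoint_open_family (underS \<kappa> k) (G k) (H k)"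
    by metis
  have "\<forall>i \<in> Field \<kappa>. \<exists>k. k \<in> K \<and> i \<in> underS \<kappa> k"
    using K(2) unfolding cofinal_def underS_def by blast
  then obtain k where k: "\<And>i. i \<in> Field \<kappa> \<Longrightarrow> k i \<in> K \<and> i \<in> underS \<kappa> (k i)"
    by metis
  have sub: "openin X (H (k i) i) \<and> H (k i) i \<noteq> {} \<and> H (k i) i \<subseteq> G (k i)" if "i \<in> Field \<kappa>" for i
    using H[of "k i"] k[OF that] unfolding disjoint_open_family_def by blast
  have GU: "G (k i) \<subseteq> U" if "i \<in> Field \<kappa>" for i
    using G k[OF that] unfolding disjoint_open_family_def by blast
  have disj: "H (k i) i \<inter> H (k j) j = {}" if ij: "i \<in> Field \<kappa>" "j \<in> Field \<kappa>" "i \<noteq> j" for i j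
  proof (cases "k i = k j")
    case True
    then show ?thesis
      using H[of "k i"] k[OF ij(1)] k[OF ij(2)] \<open>i \<noteq> j\<close>
      unfolding disjoint_open_family_def disjoint_family_on_def by simp
  next
    case False
    then have "G (k i) \<inter> G (k j) = {}"
      using G k[OF ij(1)] k[OF ij(2)] unfolding disjoint_open_family_def disjoint_family_on_def by simp
    then show ?thesis using sub[OF ij(1)] sub[OF ij(2)] by blast
  qed
  have "disjoint_open_family (Field \<kappa>) U (\<lambda>i. H (k i) i)"
    unfolding disjoint_open_family_def disjoint_family_on_def
    using sub GU disj by (auto dest: subsetD)
  then show ?thesis by blast
qed

text \<open>
  Both nonexistence results go through this bound; in each case it remains to show that no interval has
  a dense subset of size less than \<open>\<kappa>\<close>.
\<close>

lemma singular_cexp_natLeq_le: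
  fixes \<kappa> :: "'k rel"
  assumes \<kappa>: "Cinfinite \<kappa>" "\<not> regularCard \<kappa>" and compact: "compact_space X" and "A \<noteq> {}"
    and large: "\<forall>a \<in> A. \<forall>b \<in> A. \<forall>D. between a b \<noteq> {} \<and> dense_in_interval D a b \<longrightarrow> \<not> |D| <o \<kappa>"
  shows "\<kappa> ^c natLeq \<le>o |A|"
proof -
  have "|Func (UNIV :: nat set) (Field \<kappa>)| \<le>o |topspace X|"
  proof (rule nat_sequences_le_compact_Hausdorff[OF compact Hausdorff])
    show "\<exists>G. (\<forall>i \<in> Field \<kappa>. openin X (G i) \<and> G i \<noteq> {} \<and> G i \<subseteq> U) \<and> disjoint_family_on G (Field \<kappa>)"
      if "openin X U" "U \<noteq> {}" for U
      using singular_disjoint_open_family[OF \<kappa> large that]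
      unfolding disjoint_open_family_def by blast
  qed (use \<open>A \<noteq> {}\<close> in simp)
  then show ?thesis by (simp add: cexp_def Field_natLeq)
qed

text \<open>
  If the order is dense, the intervals with endpoints in \<open>D\<close> form a base of the interval.
\<close>

lemma weight_between_le:
  assumes order_dense: "\<And>x y. x \<in> A \<Longrightarrow> y \<in> A \<Longrightarrow> lt x y \<Longrightarrow> between x y \<noteq> {}"
    and D: "dense_in_interval D a b" and ab: "a \<in> A" "b \<in> A"
  shows "weight (subtopology X (between a b)) \<le>o |D \<times> D|"
proof -
  let ?B = "(\<lambda>(p, q). between p q) ` (D \<times> D)"
  have DA: "D \<subseteq> between a b" "D \<subseteq> A"
    using D unfolding dense_in_interval_def between_def by auto
  have interval_sub: "between p q \<subseteq> between a b" if "p \<in> between a b" "q \<in> between a b" for p q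
    using that trans unfolding between_def by blast
  have meets: "D \<inter> between p q \<noteq> {}" if "p \<in> A" "q \<in> A" "lt p q" "between p q \<subseteq> between a b" for p q
    using D order_dense[OF that(1-3)] openin_between[OF that(1,2)] that(4)
    unfolding dense_in_interval_def by blast
  have "base_of (subtopology X (between a b)) ?B"
    unfolding base_of_def openin_topology_base_unique
  proof (intro conjI allI impI)
    fix V assume "V \<in> ?B"
    then obtain p q where V: "V = between p q" "p \<in> D" "q \<in> D" by auto
    then have "p \<in> A" "q \<in> A" "p \<in> between a b" "q \<in> between a b" using DA by auto
    then have "openin X V" "V \<subseteq> between a b"
      using openin_between interval_sub[of p q] V(1) by auto
    then show "openin (subtopology X (between a b)) V"
      by (auto simp: openin_subtopology)
  next
    fix U x assume Ux: "openin (subtopology X (between a b)) U \<and> x \<in> U"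
    then have U: "openin X U" "U \<subseteq> between a b" "x \<in> U"
      using openin_open_subtopology[OF openin_between[OF ab]] by auto
    then have x: "x \<in> A" "lt a x" "lt x b" "x \<in> between a b" unfolding between_def by auto
    obtain p q where pq: "p \<in> A" "q \<in> A" "lt p x" "lt x q" "between p q \<subseteq> U"
      using open_contains_between[OF U(1,3) ab x(2,3)] .
    have "between p x \<subseteq> between p q" "between x q \<subseteq> between p q"
      using pq trans unfolding between_def by blast+
    then have "D \<inter> between p x \<noteq> {}" "D \<inter> between x q \<noteq> {}"
      using meets[OF pq(1) x(1) pq(3)] meets[OF x(1) pq(2) pq(4)] pq(5) U(2) by auto
    then obtain d e where de: "d \<in> D" "e \<in> D" "lt p d" "lt d x" "lt x e" "lt e q"
      unfolding between_def by auto
    then have "x \<in> between d e" "between d e \<subseteq> between p q"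
      using x trans unfolding between_def by blast+
    then show "\<exists>V. V \<in> ?B \<and> x \<in> V \<and> V \<subseteq> U"
      using de pq(5) by (intro exI[of _ "between d e"]) auto
  qed
  from weight_le[OF this] show ?thesis
    by (rule ordLeq_transitive[OF _ card_of_image])
qed

end

section \<open>The two nonexistence results\<close>

lemma linearly_ordered_spaceE:
  assumes "linearly_ordered_space X"
  obtains r where "ordered_space (topspace X) r" "X = order_topology_on (topspace X) r"
  using assms unfolding linearly_ordered_space_def ordered_space_def by blast

text \<open>
  If \<open>\<kappa>\<close> is \<open>\<aleph>\<^sub>0\<close>, the space is a countable nonempty compact Hausdorff space without isolated points,
  which is impossible. Otherwise \<open>\<kappa>\<close> is singular. An interval has size \<open>\<kappa>\<close>, so a dense subset of it
  cannot have size less than \<open>\<kappa>\<close>, and the space has at least \<open>\<kappa> ^ \<aleph>\<^sub>0\<close> points.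
\<close>

lemma no_strong_limit_homogeneous_compact_ordered_space:
  fixes \<kappa> :: "'k rel" and X :: "'a topology"
  assumes \<kappa>: "Cinfinite \<kappa>" "strong_limit \<kappa>" "\<kappa> <o \<kappa> ^c natLeq"
    and X: "compact_space X" "linearly_ordered_space X" "|topspace X| =o \<kappa>"
    and equipollent: "\<And>U V. openin X U \<Longrightarrow> U \<noteq> {} \<Longrightarrow> openin X V \<Longrightarrow> V \<noteq> {} \<Longrightarrow> U \<approx> V"
  shows False
proof -
  define A where "A = topspace X"
  obtain r where r: "ordered_space A r" and X_eq: "X = order_topology_on A r"
    using linearly_ordered_spaceE[OF X(2)] unfolding A_def by blast
  have inf: "infinite A"
    using card_of_ordIso_finite_Field[OF _ ordIso_symmetric[OF X(3)]] \<kappa>(1)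
    unfolding A_def cinfinite_def by simp
  have full: "|U| =o \<kappa>" if "openin X U" "U \<noteq> {}" for U
  proof -
    have "U \<approx> A" using equipollent[OF that openin_topspace] inf unfolding A_def by fastforce
    then show ?thesis
      unfolding eqpoll_iff_card_of_ordIso A_def by (rule ordIso_transitive[OF _ X(3)])
  qed
  have no_isolated: "\<not> openin X {x}" for x
  proof
    assume "openin X {x}"
    then have "{x} \<approx> A"
      using equipollent[of "{x}" A] inf unfolding A_def by fastforce
    then show False using inf eqpoll_finite_iff by blast
  qed
  interpret crowded_ordered_space A r
    using r no_isolated unfolding X_eq by (simp add: crowded_ordered_space_def crowded_ordered_space_axioms_def)
  have "natLeq \<le>o \<kappa>" using natLeq_ordLeq_cinfinite[OF \<kappa>(1)] .
  moreover have "\<not> natLeq =o \<kappa>"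
  proof
    assume "natLeq =o \<kappa>"
    then have "|A| =o |UNIV :: nat set|"
      using ordIso_transitive[OF ordIso_transitive[OF X(3) ordIso_symmetric] ordIso_symmetric[OF card_of_nat]]
      unfolding A_def by simp
    then obtain f :: "'a \<Rightarrow> nat" where "bij_betw f A UNIV"
      unfolding card_of_ordIso[symmetric] by (elim exE)
    then have "countable A" by (intro countableI'[of f]) (simp add: bij_betw_def)
    moreover have "(UNIV :: real set) \<lesssim> A"
    proof (rule lepoll_perfect_set)
      show "completely_metrizable_space X \<or> locally_compact_space X \<and> Hausdorff_space X"
        using X(1) Hausdorff compact_imp_locally_compact_space X_eq by blast
      show "X derived_set_of A = A"
        using no_isolated unfolding A_def derived_set_of_topspace by auto
      show "A \<noteq> {}" using inf by auto
    qed
    ultimately show False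
      using uncountable_UNIV_real countable_lepoll by blast
  qed
  ultimately have unc: "natLeq <o \<kappa>" using ordLeq_iff_ordLess_or_ordIso by blast
  have singular: "\<not> regularCard \<kappa>"
    using regular_strong_limit_cexp_natLeq[OF \<kappa>(1,2) _ unc] not_ordLess_ordLeq[OF \<kappa>(3)] by auto
  have "\<kappa> ^c natLeq \<le>o |A|"
  proof (rule singular_cexp_natLeq_le[OF \<kappa>(1) singular])
    have "\<not> |D| <o \<kappa>"
      if ab: "a \<in> A" "b \<in> A" "between a b \<noteq> {}" and D: "dense_in_interval D a b" for a b D
    proof -
      have small: "|Pow (Pow D)| <o \<kappa>" if "|D| <o \<kappa>"
        using \<kappa>(1) that by (intro card_of_Pow_ordLess_strong_limit[OF \<kappa>(2)]) simp_all
      have le: "|between a b| \<le>o |Pow (Pow D)|"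
        using D unfolding dense_in_interval_def
        by (intro card_le_Pow_Pow_dense[OF Hausdorff openin_between[OF ab(1,2)]]) simp
      have "|between a b| =o \<kappa>"
        using full[of "between a b"] openin_between[OF ab(1,2)] ab(3) X_eq by simp
      then have "\<kappa> \<le>o |Pow (Pow D)|"
        by (rule ordIso_ordLeq_trans[OF ordIso_symmetric le])
      then show ?thesis
        using not_ordLess_ordLeq[OF small] by auto
    qed
    then show "\<forall>a \<in> A. \<forall>b \<in> A. \<forall>D. between a b \<noteq> {} \<and> dense_in_interval D a b \<longrightarrow> \<not> |D| <o \<kappa>"
      by blast
  qed (use X(1) X_eq inf in auto)
  then have "\<kappa> ^c natLeq \<le>o \<kappa>"
    unfolding A_def by (rule ordLeq_ordIso_trans[OF _ X(3)])
  then show False using not_ordLess_ordLeq[OF \<kappa>(3)] by simp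
qed

text \<open>
  Connectedness makes the order dense and excludes isolated points. A dense subset \<open>D\<close> of an interval
  bounds the weight of the interval by \<open>|D \<times> D|\<close>, so \<open>D\<close> has at least \<open>\<kappa>\<close> elements.
\<close>

lemma singular_min_open_weight_continuum:
  fixes \<kappa> :: "'k rel" and X :: "'a topology"
  assumes \<kappa>: "Cinfinite \<kappa>" "\<not> regularCard \<kappa>"
    and X: "continuum X" "linearly_ordered_space X" "min_open_weight X =o \<kappa>"
  shows "\<kappa> ^c natLeq \<le>o |topspace X|"
proof -
  define A where "A = topspace X"
  obtain r where r: "ordered_space A r" and X_eq: "X = order_topology_on A r"
    using linearly_ordered_spaceE[OF X(2)] unfolding A_def by blast
  interpret ordered_space A r by (rule r)
  have compact: "compact_space X" and connected: "connected_space X" and Hausdorff: "Hausdorff_space X"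
    and nontrivial: "\<exists>x \<in> A. \<exists>y \<in> A. x \<noteq> y"
    using X(1) unfolding continuum_def A_def by auto
  have order_dense: "between x y \<noteq> {}" if xy: "x \<in> A" "y \<in> A" "lt x y" for x y
  proof
    assume empty: "between x y = {}"
    have "openin X {z \<in> A. lt z y}" "openin X {z \<in> A. lt x z}"
      using openin_less openin_greater xy X_eq by auto
    moreover have "topspace X \<subseteq> {z \<in> A. lt z y} \<union> {z \<in> A. lt x z}"
      using total xy trans unfolding A_def by blast
    moreover have "{z \<in> A. lt z y} \<inter> {z \<in> A. lt x z} = {}"
      using empty unfolding between_def by blast
    moreover have "{z \<in> A. lt z y} \<noteq> {}" "{z \<in> A. lt x z} \<noteq> {}"
      using xy by auto
    ultimately show False using connected unfolding connected_space_def by blast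
  qed
  have no_isolated: "\<not> openin X {x}" for x
  proof
    assume x: "openin X {x}"
    then have xA: "x \<in> A" using openin_subset unfolding A_def by blast
    then have "closedin X {x}"
      using Hausdorff unfolding A_def by (simp add: closedin_Hausdorff_singleton)
    then have "{x} = A"
      using x connected unfolding connected_space_clopen_in A_def by blast
    then show False using nontrivial by blast
  qed
  interpret crowded_ordered_space A r
    using r no_isolated unfolding X_eq by (simp add: crowded_ordered_space_def crowded_ordered_space_axioms_def)
  show ?thesis
    unfolding A_def[symmetric]
  proof (rule singular_cexp_natLeq_le[OF \<kappa>])
    have "\<not> |D| <o \<kappa>"
      if ab: "a \<in> A" "b \<in> A" "between a b \<noteq> {}" and D: "dense_in_interval D a b" for a b D
    proof -
      have "topspace X \<noteq> {}" using nontrivial unfolding A_def by blast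
      moreover have "openin X (between a b)" using openin_between[OF ab(1,2)] X_eq by simp
      ultimately have "min_open_weight X \<le>o weight (subtopology X (between a b))"
        using ab(3) by (rule min_open_weight_le)
      moreover have "weight (subtopology X (between a b)) \<le>o |D \<times> D|"
        using weight_between_le[OF order_dense D ab(1,2)] X_eq by simp
      ultimately have "min_open_weight X \<le>o |D \<times> D|" by (rule ordLeq_transitive)
      then have "\<kappa> \<le>o |D \<times> D|"
        by (rule ordIso_ordLeq_trans[OF ordIso_symmetric[OF X(3)]])
      then show ?thesis
        using not_ordLess_ordLeq[OF card_of_Times_ordLess_Cinfinite[OF \<kappa>(1)]] by auto
    qed
    then show "\<forall>a \<in> A. \<forall>b \<in> A. \<forall>D. between a b \<noteq> {} \<and> dense_in_interval D a b \<longrightarrow> \<not> |D| <o \<kappa>"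
      by blast
  qed (use compact X_eq nontrivial in auto)
qed

theorem theorem7:
  fixes \<kappa> :: "'k rel"
  assumes "Cinfinite \<kappa>"
  shows "(strong_limit \<kappa> \<and> \<kappa> <o \<kappa> ^c natLeq \<longrightarrow>
           \<not> (\<exists>X :: 'a topology.
                compact_space X \<and> linearly_ordered_space X \<and> |topspace X| =o \<kappa> \<and>
                (\<forall>U V. openin X U \<and> U \<noteq> {} \<and> openin X V \<and> V \<noteq> {} \<longrightarrow> U \<approx> V)))
       \<and> (\<not> regularCard \<kappa> \<longrightarrow>
           \<not> (\<exists>X :: 'b topology.
                continuum X \<and> linearly_ordered_space X \<and>
                min_open_weight X =o \<kappa> \<and> |topspace X| <o \<kappa> ^c natLeq))"
proof (intro conjI impI notI; elim exE conjE)
  fix X :: "'a topology"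
  assume "strong_limit \<kappa>" "\<kappa> <o \<kappa> ^c natLeq" "compact_space X" "linearly_ordered_space X"
    "|topspace X| =o \<kappa>" "\<forall>U V. openin X U \<and> U \<noteq> {} \<and> openin X V \<and> V \<noteq> {} \<longrightarrow> U \<approx> V"
  then show False
    using no_strong_limit_homogeneous_compact_ordered_space[OF assms, of X] by blast
next
  fix X :: "'b topology"
  assume "\<not> regularCard \<kappa>" "continuum X" "linearly_ordered_space X" "min_open_weight X =o \<kappa>"
  then have "\<kappa> ^c natLeq \<le>o |topspace X|"
    using singular_min_open_weight_continuum[OF assms] by blast
  moreover assume "|topspace X| <o \<kappa> ^c natLeq"
  ultimately show False using not_ordLess_ordLeq[of "|topspace X|" "\<kappa> ^c natLeq"] by simp
qed

end
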